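(* Let $G=(V,E)$, centralities, importances, $G_{2\text{-hop}}$ and $H=(h_1,\dots,h_{|H|})$ be as in the context. Let $P_0$ be the partition of $V$ into singletons and, for $1\le t\le |H|$, let $P_t$ be obtained from $P_{t-1}$ by merging the two parts containing the endpoints of $h_t$ (leaving it unchanged if they are already in the same part). Let $\mathcal{G}^t$ denote the summary of $P_t$ (so $\mathcal{G}^0$ is $G$ itself). Then $u(\mathcal{G}^{t-1})\ge u(\mathcal{G}^t)$ for every $1\le t\le|H|$.
   Context: $G=(V,E)$ is a finite simple undirected graph with node centralities $(C_x)_{x\in V}$. Edge importances $C(u,v)>0$ for $\{u,v\}\in E$ sum to $1$; spurious importances $C_s(u,v)\ge0$ for non-adjacent distinct pairs $\{u,v\}$ sum to $1$. $F=\{\{a,c\}: a\neq c,\ \exists b \text{ with } \{a,b\},\{b,c\}\in E\}$, $G_{2\text{-hop}}=(V,F)$ weighted by $w(a,c)=C_a+C_c$, and $H$ is the list of edges of a minimum spanning forest of $G_{2\text{-hop}}$ sorted in nondecreasing order of weight. For a partition $\mathcal{V}$ of $V$ and parts $X,Y$ (possibly equal), $\mathrm{nSedge}(X,Y)$ is the sum of $C(x,y)$ over edges $\{x,y\}\in E$ with $x\in X,y\in Y$ (for $X=Y$: over unordered pairs of distinct nodes of $X$), and $\mathrm{Sedge}(X,Y)$ is the analogous sum of $C_s(x,y)$ over non-adjacent pairs. The summary of $\mathcal{V}$ has superedge $\{X,Y\}$ iff some edge of $G$ joins $X$ and $Y$ (lies inside $X$ if $X=Y$) and $\mathrm{Sedge}(X,Y)\le\mathrm{nSedge}(X,Y)$;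 its utility is $u=\sum_{\{X,Y\}\text{ superedge}}(\mathrm{nSedge}(X,Y)-\mathrm{Sedge}(X,Y))$. *)

theory Defs
  imports Complex_Main "HOL-Library.Disjoint_Sets"
begin

(* Unordered pairs are two-element sets; importances are functions on unordered pairs. *)

definition simple_graph :: "'a set \<Rightarrow> 'a set set \<Rightarrow> bool" where
  "simple_graph V E \<longleftrightarrow> finite V \<and> (\<forall>e\<in>E. e \<subseteq> V \<and> card e = 2)"

definition nonadjacent :: "'a set \<Rightarrow> 'a set set \<Rightarrow> 'a set set" where
  "nonadjacent V E = {{x, y} | x y. x \<in> V \<and> y \<in> V \<and> x \<noteq> y \<and> {x, y} \<notin> E}"

definition edge_importances :: "'a set set \<Rightarrow> ('a set \<Rightarrow> real) \<Rightarrow> bool" where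
  "edge_importances E C \<longleftrightarrow> (\<forall>e\<in>E. C e > 0) \<and> (\<Sum>e\<in>E. C e) = 1"

definition spurious_importances ::
    "'a set \<Rightarrow> 'a set set \<Rightarrow> ('a set \<Rightarrow> real) \<Rightarrow> bool" where
  "spurious_importances V E Cs \<longleftrightarrow>
     (\<forall>e\<in>nonadjacent V E. Cs e \<ge> 0) \<and> (\<Sum>e\<in>nonadjacent V E. Cs e) = 1"


subsection \<open>The 2-hop graph and minimum spanning forests\<close>

definition two_hop :: "'a set set \<Rightarrow> 'a set set" where
  "two_hop E = {{a, c} | a c. a \<noteq> c \<and> (\<exists>b. {a, b} \<in> E \<and> {b, c} \<in> E)}"

(* On a two-element set {a, c} this is Cn a + Cn c. *)
definition hop_weight :: "('a \<Rightarrow> real) \<Rightarrow> 'a set \<Rightarrow> real" where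
  "hop_weight Cn e = (\<Sum>x\<in>e. Cn x)"

definition cycle_in :: "'a set set \<Rightarrow> 'a list \<Rightarrow> bool" where
  "cycle_in T p \<longleftrightarrow> length p \<ge> 3 \<and> distinct p \<and>
     (\<forall>i<length p. {p ! i, p ! (Suc i mod length p)} \<in> T)"

definition reach :: "'a set set \<Rightarrow> ('a \<times> 'a) set" where
  "reach T = {(x, y). {x, y} \<in> T}\<^sup>*"

(* A spanning forest of (V, F) has vertex set V, so it is given by its edge set. *)
definition spanning_forest :: "'a set set \<Rightarrow> 'a set set \<Rightarrow> bool" where
  "spanning_forest F T \<longleftrightarrow> T \<subseteq> F \<and> (\<nexists>p. cycle_in T p) \<and> reach T = reach F"

definition min_spanning_forest ::
    "('a set \<Rightarrow> real) \<Rightarrow> 'a set set \<Rightarrow> 'a set set \<Rightarrow> bool" where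
  "min_spanning_forest w F T \<longleftrightarrow> spanning_forest F T \<and>
     (\<forall>T'. spanning_forest F T' \<longrightarrow> (\<Sum>e\<in>T. w e) \<le> (\<Sum>e\<in>T'. w e))"

(* Ties in the weights, and the choice among several minimum spanning forests, are left open. *)
definition sorted_msf :: "('a \<Rightarrow> real) \<Rightarrow> 'a set set \<Rightarrow> 'a set list \<Rightarrow> bool" where
  "sorted_msf Cn E H \<longleftrightarrow>
     min_spanning_forest (hop_weight Cn) (two_hop E) (set H) \<and>
     distinct H \<and> sorted (map (hop_weight Cn) H)"


subsection \<open>Summaries and their utility\<close>

(* An unordered pair {X, Y} of parts is a set p of parts, with p = {X} when X = Y. The pairs of
   S joined by p are the {x, y} in S with x in X and y in Y. *)
definition pairs_across :: "'a set set \<Rightarrow> 'a set set \<Rightarrow> 'a set set" where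
  "pairs_across S p = {{x, y} | x y. {x, y} \<in> S \<and> (\<exists>X Y. p = {X, Y} \<and> x \<in> X \<and> y \<in> Y)}"

definition nSedge :: "'a set set \<Rightarrow> ('a set \<Rightarrow> real) \<Rightarrow> 'a set set \<Rightarrow> real" where
  "nSedge E C p = (\<Sum>e\<in>pairs_across E p. C e)"

definition Sedge :: "'a set \<Rightarrow> 'a set set \<Rightarrow> ('a set \<Rightarrow> real) \<Rightarrow> 'a set set \<Rightarrow> real" where
  "Sedge V E Cs p = (\<Sum>e\<in>pairs_across (nonadjacent V E) p. Cs e)"

(* A summary is a graph on the parts, given as (supernodes, superedges). *)
definition summary :: "'a set \<Rightarrow> 'a set set \<Rightarrow> ('a set \<Rightarrow> real) \<Rightarrow> ('a set \<Rightarrow> real) \<Rightarrow>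
    'a set set \<Rightarrow> 'a set set \<times> 'a set set set" where
  "summary V E C Cs P =
     (P, {{X, Y} | X Y. X \<in> P \<and> Y \<in> P \<and> pairs_across E {X, Y} \<noteq> {} \<and>
                        Sedge V E Cs {X, Y} \<le> nSedge E C {X, Y}})"

definition utility :: "'a set \<Rightarrow> 'a set set \<Rightarrow> ('a set \<Rightarrow> real) \<Rightarrow> ('a set \<Rightarrow> real) \<Rightarrow>
    'a set set \<times> 'a set set set \<Rightarrow> real" where
  "utility V E C Cs S = (\<Sum>p\<in>snd S. nSedge E C p - Sedge V E Cs p)"


subsection \<open>Merging along a list of edges\<close>

(* Replaces the parts that contain an endpoint of h by their union; if both endpoints lie in
   one part, this leaves P unchanged. *)
definition merge_parts :: "'a set set \<Rightarrow> 'a set \<Rightarrow> 'a set set" where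
  "merge_parts P h = {X \<in> P. X \<inter> h = {}} \<union> {\<Union>{X \<in> P. X \<inter> h \<noteq> {}}}"

(* The edge h_t of an informally 1-based list is H ! (t - 1), so step Suc t uses H ! t. *)
fun merged_partition :: "'a set \<Rightarrow> 'a set list \<Rightarrow> nat \<Rightarrow> 'a set set" where
  "merged_partition V H 0 = {{x} | x. x \<in> V}"
| "merged_partition V H (Suc t) = merge_parts (merged_partition V H t) (H ! t)"


subsection \<open>Consistency checks\<close>

lemma merge_parts_eq:
  assumes P: "partition_on V P" and X: "X \<in> P" "a \<in> X" and Y: "Y \<in> P" "b \<in> Y"
  shows "merge_parts P {a, b} = P - {X, Y} \<union> {X \<union> Y}"
proof -
  have eq: "Z = W" if "Z \<in> P" "W \<in> P" "x \<in> Z" "x \<in> W" for Z W x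
    using that partition_onD2[OF P] unfolding disjoint_def by blast
  have "{Z \<in> P. Z \<inter> {a, b} \<noteq> {}} = {X, Y}"
    using X Y eq by blast
  moreover have "{Z \<in> P. Z \<inter> {a, b} = {}} = P - {Z \<in> P. Z \<inter> {a, b} \<noteq> {}}"
    by blast
  ultimately show ?thesis
    unfolding merge_parts_def by simp
qed

lemma partition_on_merged_partition:
  assumes "\<And>h. h \<in> set H \<Longrightarrow> h \<subseteq> V \<and> card h = 2" and "t \<le> length H"
  shows "partition_on V (merged_partition V H t)"
  using assms(2)
proof (induction t)
  case 0
  show ?case by (auto simp: partition_on_def disjoint_def)
next
  case (Suc t)
  let ?P = "merged_partition V H t"
  have P: "partition_on V ?P" using Suc by simp
  from Suc.prems have "H ! t \<in> set H" by simp
  with assms(1) have "H ! t \<subseteq> V" "card (H ! t) = 2" by auto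
  then obtain a b where h: "H ! t = {a, b}" "a \<in> V" "b \<in> V"
    by (auto simp: card_2_iff)
  with P obtain X Y where XY: "X \<in> ?P" "a \<in> X" "Y \<in> ?P" "b \<in> Y"
    by (metis UnionE partition_onD1)
  have "merged_partition V H (Suc t) = ?P - {X, Y} \<union> {X \<union> Y}"
    using merge_parts_eq[OF P XY] h by simp
  moreover have "partition_on V (?P - {X, Y} \<union> {X \<union> Y})"
  proof (rule partition_onI)
    show "\<Union> (?P - {X, Y} \<union> {X \<union> Y}) = V"
      using partition_onD1[OF P] XY by blast
    show "{} \<notin> ?P - {X, Y} \<union> {X \<union> Y}"
      using partition_onD3[OF P] XY by auto
    have dj: "disjnt Z W" if "Z \<in> ?P" "W \<in> ?P" "Z \<noteq> W" for Z W
      using partition_onD2[OF P] that unfolding disjoint_def disjnt_def by simp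
    show "disjnt Z W"
      if ZW: "Z \<in> ?P - {X, Y} \<union> {X \<union> Y}" "W \<in> ?P - {X, Y} \<union> {X \<union> Y}" "Z \<noteq> W" for Z W
    proof -
      have new: "disjnt Z' (X \<union> Y)" if "Z' \<in> ?P - {X, Y}" for Z'
        using that dj[of Z' X] dj[of Z' Y] XY by simp
      consider "Z \<in> ?P" "W \<in> ?P" | "Z \<in> ?P - {X, Y}" "W = X \<union> Y" | "W \<in> ?P - {X, Y}" "Z = X \<union> Y"
        using ZW by blast
      then show ?thesis
        using dj[of Z W] new[of Z] new[of W] ZW(3) disjnt_sym[of W Z] by cases auto
    qed
  qed
  ultimately show ?case by simp
qed

(* The summary of the singleton partition is G itself, up to identifying x with {x}. *)
lemma summary_singletons:
  assumes G: "simple_graph V E" and C: "edge_importances E C"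
  shows "summary V E C Cs (merged_partition V H 0) =
           ((\<lambda>x. {x}) ` V, (\<lambda>e. (\<lambda>x. {x}) ` e) ` E)"
proof -
  have across: "pairs_across S {{x}, {y}} = (if {x, y} \<in> S then {{x, y}} else {})"
    for S :: "'a set set" and x y
    unfolding pairs_across_def by (auto simp: doubleton_eq_iff) (auto simp: insert_commute)
  have pos: "Sedge V E Cs {{x}, {y}} \<le> nSedge E C {{x}, {y}}" if "{x, y} \<in> E" for x y
  proof -
    have "{x, y} \<notin> nonadjacent V E"
      using that by (auto simp: nonadjacent_def)
    with that C show ?thesis
      unfolding Sedge_def nSedge_def across edge_importances_def by (simp add: less_imp_le)
  qed
  have E: "\<exists>x\<in>V. \<exists>y\<in>V. e = {x, y}" if "e \<in> E" for e
  proof -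
    from that G have "e \<subseteq> V" "card e = 2" by (auto simp: simple_graph_def)
    then show ?thesis by (auto simp: card_2_iff)
  qed
  have "{{X, Y} | X Y. X \<in> {{x} | x. x \<in> V} \<and> Y \<in> {{x} | x. x \<in> V} \<and>
          pairs_across E {X, Y} \<noteq> {} \<and> Sedge V E Cs {X, Y} \<le> nSedge E C {X, Y}}
        = (\<lambda>e. (\<lambda>x. {x}) ` e) ` E" (is "?L = ?R")
  proof
    show "?L \<subseteq> ?R"
    proof
      fix p assume "p \<in> ?L"
      then obtain x y where p: "p = {{x}, {y}}" "pairs_across E {{x}, {y}} \<noteq> {}" by blast
      then have "{x, y} \<in> E" by (auto simp: across split: if_splits)
      moreover have "p = (\<lambda>x. {x}) ` {x, y}" using p by simp
      ultimately show "p \<in> ?R" by blast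
    qed
    show "?R \<subseteq> ?L"
    proof
      fix p assume "p \<in> ?R"
      then obtain e where e: "e \<in> E" "p = (\<lambda>x. {x}) ` e" by blast
      with E obtain x y where xy: "x \<in> V" "y \<in> V" "e = {x, y}" by blast
      then have "p = {{x}, {y}}" "pairs_across E {{x}, {y}} \<noteq> {}"
        using e by (auto simp: across)
      moreover have "Sedge V E Cs {{x}, {y}} \<le> nSedge E C {{x}, {y}}"
        using pos xy e by simp
      ultimately show "p \<in> ?L"
        using xy by (intro CollectI exI[of _ "{x}"] exI[of _ "{y}"]) auto
    qed
  qed
  moreover have "{{x} | x. x \<in> V} = (\<lambda>x. {x}) ` V" by blast
  ultimately show ?thesis
    unfolding summary_def by simp
qed

end

theory Submission
  imports Defs
begin

text \<open>
  Give each edge e the value C e and each non-adjacent pair the value - Cs e. The utility of the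
  summary of a partition P is the sum, over the unordered pairs of parts, of the positive part of
  the total value of the node pairs between them. If P refines Q, the node pairs between two parts
  of Q are the disjoint union of those between pairs of parts of P, and the positive part is
  subadditive, so the utility can only drop. Merging parts coarsens a partition.
\<close>

text \<open>Each fibre of the composite is a disjoint union of fibres of \<open>h\<close>, and the
  positive part of a sum is at most the sum of the positive parts. In the application
  \<open>h\<close> groups node pairs by fine parts and \<open>g\<close> passes to coarse
  parts.\<close>

lemma sum_max_0_image_comp_le:
  fixes f :: "'a \<Rightarrow> real"
  assumes "finite A"
  shows "(\<Sum>q\<in>(\<lambda>x. g (h x)) ` A. max 0 (\<Sum>x\<in>{x\<in>A. g (h x) = q}. f x))
       \<le> (\<Sum>p\<in>h ` A. max 0 (\<Sum>x\<in>{x\<in>A. h x = p}. f x))"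
proof -
  have "max 0 (\<Sum>x\<in>{x\<in>A. g (h x) = q}. f x)
      \<le> (\<Sum>p\<in>{p\<in>h ` A. g p = q}. max 0 (\<Sum>x\<in>{x\<in>A. h x = p}. f x))" for q
  proof -
    have "(\<Sum>x\<in>{x\<in>A. g (h x) = q}. f x)
        = (\<Sum>p\<in>h ` {x\<in>A. g (h x) = q}. \<Sum>x\<in>{x\<in>{x\<in>A. g (h x) = q}. h x = p}. f x)"
      using assms by (intro sum.image_gen) simp
    \<comment> \<open>For \<open>g p = q\<close>, the condition \<open>h x = p\<close> already
      forces \<open>g (h x) = q\<close>.\<close>
    also have "\<dots> = (\<Sum>p\<in>{p\<in>h ` A. g p = q}. \<Sum>x\<in>{x\<in>A. h x = p}. f x)"
      by (intro sum.cong) auto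
    also have "\<dots> \<le> (\<Sum>p\<in>{p\<in>h ` A. g p = q}. max 0 (\<Sum>x\<in>{x\<in>A. h x = p}. f x))"
      by (intro sum_mono) simp
    finally show ?thesis
      by (simp add: sum_nonneg)
  qed
  then have "(\<Sum>q\<in>g ` h ` A. max 0 (\<Sum>x\<in>{x\<in>A. g (h x) = q}. f x))
      \<le> (\<Sum>q\<in>g ` h ` A. \<Sum>p\<in>{p\<in>h ` A. g p = q}. max 0 (\<Sum>x\<in>{x\<in>A. h x = p}. f x))"
    by (intro sum_mono)
  also have "\<dots> = (\<Sum>p\<in>h ` A. max 0 (\<Sum>x\<in>{x\<in>A. h x = p}. f x))"
    using assms by (intro sum.image_gen[symmetric]) simp
  finally show ?thesis
    by (simp add: image_image)
qed

text \<open>The union serves as a description operator: for a partition of \<open>V\<close> and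
  \<open>x\<close> in \<open>V\<close> it ranges over one part only; outside \<open>V\<close> the
  value is \<open>{}\<close>.\<close>

definition part_of :: "'a set set \<Rightarrow> 'a \<Rightarrow> 'a set" where
  "part_of P x = \<Union>{X \<in> P. x \<in> X}"

lemma part_of_eq:
  assumes "partition_on V P" "X \<in> P" "x \<in> X"
  shows "part_of P x = X"
proof -
  have "{Z \<in> P. x \<in> Z} = {X}"
    using assms partition_onD2[OF assms(1)] unfolding disjoint_def by blast
  then show ?thesis
    by (simp add: part_of_def)
qed

lemma part_of:
  assumes "partition_on V P" "x \<in> V"
  shows "part_of P x \<in> P" "x \<in> part_of P x"
proof -
  obtain X where "X \<in> P" "x \<in> X"
    using assms partition_onD1 by blast
  then show "part_of P x \<in> P" "x \<in> part_of P x"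
    using part_of_eq[OF assms(1)] by auto
qed

text \<open>The fine part of \<open>x\<close> is nonempty, so it lies in only one coarse part. Hence
  the coarse part is a function of the fine part alone, which lets the coarse grouping factor
  through the fine one.\<close>

lemma part_of_refines:
  assumes "refines V P Q" "x \<in> V"
  shows "part_of Q x = \<Union>{Y \<in> Q. part_of P x \<subseteq> Y}"
proof -
  have P: "partition_on V P" and Q: "partition_on V Q"
    using assms(1) by (auto simp: refines_def)
  obtain Y where Y: "Y \<in> Q" "part_of P x \<subseteq> Y"
    using assms(1) part_of(1)[OF P assms(2)] unfolding refines_def by blast
  have x: "x \<in> part_of P x"
    using part_of(2)[OF P assms(2)] .
  have "Z = part_of Q x" if "Z \<in> Q" "part_of P x \<subseteq> Z" for Z
    using part_of_eq[OF Q that(1)] that(2) x by auto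
  with Y have "{Y \<in> Q. part_of P x \<subseteq> Y} = {part_of Q x}"
    by blast
  then show ?thesis
    by simp
qed

text \<open>Each node determines its part, so the node pairs between two parts form a fibre of the
  image map of \<open>part_of P\<close>. A pair inside one part has a singleton image, which covers
  \<open>X = Y\<close>.\<close>

lemma pairs_across_part_of:
  assumes P: "partition_on V P" and S: "\<And>e. e \<in> S \<Longrightarrow> e \<subseteq> V \<and> card e = 2"
    and XY: "X \<in> P" "Y \<in> P"
  shows "pairs_across S {X, Y} = {e \<in> S. part_of P ` e = {X, Y}}"
proof (intro set_eqI iffI)
  fix e assume "e \<in> pairs_across S {X, Y}"
  then obtain x y X' Y' where e: "e = {x, y}" "e \<in> S" "{X, Y} = {X', Y'}" "x \<in> X'" "y \<in> Y'"
    by (auto simp: pairs_across_def)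
  then have "X' \<in> P" "Y' \<in> P"
    using XY by (auto simp: doubleton_eq_iff)
  then show "e \<in> {e \<in> S. part_of P ` e = {X, Y}}"
    using e part_of_eq[OF P] by auto
next
  fix e assume e: "e \<in> {e \<in> S. part_of P ` e = {X, Y}}"
  then obtain x y where xy: "e = {x, y}" "x \<in> V" "y \<in> V"
    using S[of e] by (auto simp: card_2_iff)
  then have "{X, Y} = {part_of P x, part_of P y}" "{x, y} \<in> S"
    using e by auto
  then show "e \<in> pairs_across S {X, Y}"
    using part_of(2)[OF P] xy unfolding pairs_across_def
    by (intro CollectI exI[of _ x] exI[of _ y] conjI exI[of _ "part_of P x"]
        exI[of _ "part_of P y"]) simp_all
qed

lemma nonadjacent_subset_Pow: "nonadjacent V E \<subseteq> Pow V"
  by (auto simp: nonadjacent_def)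

lemma nonadjacent_disjoint: "E \<inter> nonadjacent V E = {}"
  by (auto simp: nonadjacent_def)

lemma finite_simple_graph:
  assumes "simple_graph V E"
  shows "finite E" "finite (nonadjacent V E)"
proof -
  have "E \<subseteq> Pow V" "finite (Pow V)"
    using assms by (auto simp: simple_graph_def)
  then show "finite E" "finite (nonadjacent V E)"
    using nonadjacent_subset_Pow[of V E] by (auto intro: finite_subset)
qed

text \<open>One signed function on all node pairs turns \<open>nSedge - Sedge\<close> into a single
  sum, to which subadditivity applies. The second branch is meant for non-adjacent pairs.\<close>

definition pair_value ::
    "'a set set \<Rightarrow> ('a set \<Rightarrow> real) \<Rightarrow> ('a set \<Rightarrow> real) \<Rightarrow> 'a set \<Rightarrow> real" where
  "pair_value E C Cs e = (if e \<in> E then C e else - Cs e)"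

text \<open>The inequality in the superedge condition selects the nonnegative differences, as a
  positive part does. Pairs of parts joined by no edge have a nonpositive difference and contribute
  zero.\<close>

lemma utility_summary_eq:
  assumes G: "simple_graph V E" and Cs: "spurious_importances V E Cs"
    and P: "partition_on V P"
  shows "utility V E C Cs (summary V E C Cs P) =
    (\<Sum>p\<in>(`) (part_of P) ` (E \<union> nonadjacent V E).
       max 0 (\<Sum>e\<in>{e \<in> E \<union> nonadjacent V E. part_of P ` e = p}. pair_value E C Cs e))"
    (is "_ = (\<Sum>p\<in>?Q. max 0 (?v p))")
proof -
  let ?N = "nonadjacent V E"
  let ?S = "snd (summary V E C Cs P)"
  have fin: "finite E" "finite ?N"
    using finite_simple_graph[OF G] .
  have E: "e \<subseteq> V \<and> card e = 2" if "e \<in> E" for e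
    using G that by (auto simp: simple_graph_def)
  have N: "e \<subseteq> V \<and> card e = 2" if "e \<in> ?N" for e
    using that by (auto simp: nonadjacent_def)
  have v: "?v p = nSedge E C p - Sedge V E Cs p"
    and EE: "pairs_across E p = {e \<in> E. part_of P ` e = p}"
    and NN: "pairs_across ?N p = {e \<in> ?N. part_of P ` e = p}"
    if "p = {X, Y}" "X \<in> P" "Y \<in> P" for p X Y
  proof -
    show EE: "pairs_across E p = {e \<in> E. part_of P ` e = p}"
      using pairs_across_part_of[OF P E] that by simp
    show NN: "pairs_across ?N p = {e \<in> ?N. part_of P ` e = p}"
      using pairs_across_part_of[OF P N] that by simp
    have "?v p = (\<Sum>e\<in>{e \<in> E. part_of P ` e = p} \<union> {e \<in> ?N. part_of P ` e = p}.
        pair_value E C Cs e)"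
      by (rule sum.cong) auto
    also have "\<dots> = (\<Sum>e\<in>{e \<in> E. part_of P ` e = p}. pair_value E C Cs e)
        + (\<Sum>e\<in>{e \<in> ?N. part_of P ` e = p}. pair_value E C Cs e)"
      using fin nonadjacent_disjoint[of E V] by (intro sum.union_disjoint) auto
    also have "(\<Sum>e\<in>{e \<in> E. part_of P ` e = p}. pair_value E C Cs e) = nSedge E C p"
      unfolding nSedge_def EE by (rule sum.cong) (auto simp: pair_value_def)
    also have "(\<Sum>e\<in>{e \<in> ?N. part_of P ` e = p}. pair_value E C Cs e) = - Sedge V E Cs p"
      unfolding Sedge_def NN sum_negf[symmetric] using nonadjacent_disjoint[of E V]
      by (intro sum.cong) (auto simp: pair_value_def)
    finally show "?v p = nSedge E C p - Sedge V E Cs p"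
      by simp
  qed
  have Q: "\<exists>X Y. p = {X, Y} \<and> X \<in> P \<and> Y \<in> P" if "p \<in> ?Q" for p
  proof -
    from that obtain e where e: "e \<subseteq> V" "card e = 2" "p = part_of P ` e"
      using E N by blast
    then obtain x y where "e = {x, y}"
      by (auto simp: card_2_iff)
    then have "p = {part_of P x, part_of P y}" "part_of P x \<in> P" "part_of P y \<in> P"
      using e part_of(1)[OF P] by auto
    then show ?thesis
      by blast
  qed
  have S: "?S = {{X, Y} | X Y. X \<in> P \<and> Y \<in> P \<and> pairs_across E {X, Y} \<noteq> {} \<and>
      Sedge V E Cs {X, Y} \<le> nSedge E C {X, Y}}"
    by (simp add: summary_def)
  \<comment> \<open>A superedge is the image of any edge of \<open>E\<close> that it joins.\<close>
  have sub: "?S \<subseteq> ?Q"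
  proof
    fix p assume "p \<in> ?S"
    then obtain X Y where "p = {X, Y}" "X \<in> P" "Y \<in> P" "pairs_across E p \<noteq> {}"
      unfolding S by blast
    then show "p \<in> ?Q"
      using EE by blast
  qed
  have "utility V E C Cs (summary V E C Cs P) = (\<Sum>p\<in>?S. max 0 (?v p))"
    unfolding utility_def
  proof (rule sum.cong)
    fix p assume "p \<in> ?S"
    then obtain X Y where p: "p = {X, Y}" "X \<in> P" "Y \<in> P"
      and le: "Sedge V E Cs p \<le> nSedge E C p"
      unfolding S by blast
    show "nSedge E C p - Sedge V E Cs p = max 0 (?v p)"
      unfolding v[OF p] using le by simp
  qed simp
  also have "\<dots> = (\<Sum>p\<in>?Q. max 0 (?v p))"
  proof (rule sum.mono_neutral_left)
    show "\<forall>p\<in>?Q - ?S. max 0 (?v p) = 0"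
    proof
      fix p assume p: "p \<in> ?Q - ?S"
      then obtain X Y where XY: "p = {X, Y}" "X \<in> P" "Y \<in> P"
        using Q[OF DiffD1] by metis
      \<comment> \<open>This settles the case in which \<open>p\<close> fails to be a superedge for
        lack of edges: there \<open>nSedge\<close> is an empty sum.\<close>
      have "Sedge V E Cs p \<ge> 0"
        unfolding Sedge_def NN[OF XY] using Cs
        by (intro sum_nonneg) (auto simp: spurious_importances_def)
      moreover have "pairs_across E p = {} \<or> nSedge E C p < Sedge V E Cs p"
      proof (rule ccontr)
        assume "\<not> ?thesis"
        then have "p \<in> ?S"
          unfolding S using XY by (intro CollectI exI[of _ X] exI[of _ Y]) simp
        then show False
          using p by simp
      qed
      ultimately have "nSedge E C p - Sedge V E Cs p \<le> 0"
        by (auto simp: nSedge_def)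
      then show "max 0 (?v p) = 0"
        unfolding v[OF XY] by simp
    qed
  qed (use fin sub in auto)
  finally show ?thesis .
qed

text \<open>Both utilities sum positive parts over groupings of the same node pairs, and the
  grouping by \<open>Q\<close> merges groups of the grouping by \<open>P\<close>.\<close>

theorem utility_refines_le:
  assumes G: "simple_graph V E" and Cs: "spurious_importances V E Cs"
    and ref: "refines V P Q"
  shows "utility V E C Cs (summary V E C Cs Q) \<le> utility V E C Cs (summary V E C Cs P)"
proof -
  define A where "A = E \<union> nonadjacent V E"
  \<comment> \<open>Sends each part of \<open>P\<close> in \<open>p\<close> to the part of
    \<open>Q\<close> containing it, in the form supplied by \<open>part_of_refines\<close>.\<close>
  define g where "g p = (\<lambda>X. \<Union>{Y \<in> Q. X \<subseteq> Y}) ` p" for p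
  have P: "partition_on V P" and Q: "partition_on V Q"
    using ref by (auto simp: refines_def)
  have "finite A"
    using finite_simple_graph[OF G] by (simp add: A_def)
  have "e \<subseteq> V" if "e \<in> A" for e
    using that G nonadjacent_subset_Pow[of V E] by (auto simp: A_def simple_graph_def)
  then have "part_of Q ` e = g (part_of P ` e)" if "e \<in> A" for e
    unfolding g_def image_image using that
    by (intro image_cong part_of_refines[OF ref]) auto
  then have *: "(`) (part_of Q) ` A = (\<lambda>e. g (part_of P ` e)) ` A"
    "{e \<in> A. part_of Q ` e = p} = {e \<in> A. g (part_of P ` e) = p}" for p
    by auto
  show ?thesis
    unfolding utility_summary_eq[OF G Cs P] utility_summary_eq[OF G Cs Q] A_def[symmetric] *
    by (rule sum_max_0_image_comp_le[OF \<open>finite A\<close>])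
qed

theorem theorem4p2:
  fixes V :: "'a set" and E :: "'a set set"
    and Cn :: "'a \<Rightarrow> real" and C Cs :: "'a set \<Rightarrow> real"
    and H :: "'a set list" and t :: nat
  assumes "simple_graph V E"
    and "edge_importances E C"
    and "spurious_importances V E Cs"
    and "sorted_msf Cn E H"
    and "1 \<le> t" and "t \<le> length H"
  shows "utility V E C Cs (summary V E C Cs (merged_partition V H (t - 1)))
         \<ge> utility V E C Cs (summary V E C Cs (merged_partition V H t))"
proof -
  have "set H \<subseteq> two_hop E"
    using assms(4) by (simp add: sorted_msf_def min_spanning_forest_def spanning_forest_def)
  \<comment> \<open>The two distinct nodes of a 2-hop pair are endpoints of edges of
    \<open>E\<close>, hence lie in \<open>V\<close>.\<close>
  then have H: "h \<subseteq> V \<and> card h = 2" if "h \<in> set H" for h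
    using that assms(1) by (fastforce simp: two_hop_def simple_graph_def)
  obtain s where s: "t = Suc s"
    using assms(5) by (cases t) auto
  \<comment> \<open>A part that misses \<open>h\<close> survives; one that meets \<open>h\<close> is
    absorbed into the new union.\<close>
  have "\<exists>Y\<in>merge_parts P h. X \<subseteq> Y" if "X \<in> P" for X :: "'a set" and P h
    using that by (cases "X \<inter> h = {}") (auto simp: merge_parts_def)
  then have "refines V (merged_partition V H s) (merged_partition V H t)"
    using partition_on_merged_partition[OF H, where t = s]
      partition_on_merged_partition[OF H, where t = t]
      assms(6) by (simp add: refines_def s)
  then show ?thesis
    using utility_refines_le[OF assms(1,3)] s by simp
qed

end
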